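(* Fix $\lambda_H,\lambda_E>0$, $p_E\in(0,1]$ and an integer $d\ge1$ (independent of $p_H$). Under the ChainMatch(d) policy and in steady-state, the chain-segment length $L$ satisfies $$\lim_{p_H\to0}\mathbb{E}[L\mid L\ge1]=\frac{\lambda_H+\lambda_E(1-p_E)^d}{\lambda_E(1-(1-p_E)^d)}+1.$$
   Context: Model: agents of two types $H$ (hard-to-match) and $E$ (easy-to-match) arrive to a market according to independent Poisson processes with rates $\lambda_H,\lambda_E>0$. Each agent owns an item; an agent of type $T\in\{H,E\}$ finds the item of any other agent compatible with probability $p_T$, independently over all ordered pairs; there is a directed edge from $i$ to $j$ if $j$ finds $i$'s item compatible. Here $p_E\in(0,1]$ is a fixed constant and $p_H\in(0,1)$ is a parameter tending to $0$. A waiting agent leaves only when matched, i.e. when she receives a compatible item. Policy ChainMatch(d) ($\mathcal{C}(d)$): the market starts with $d$ altruistic agents, who give an item without requiring one; at all times there are exactly $d$ bridge agents (an altruistic agent who has not yet given, or an agent who has received an item but not yet given hers). When a new agent $i_1$ arrives: if no bridge agent has an edge to $i_1$, then $i_1$ joins the market and waits. Otherwise one of the bridge agents with an edge to $i_1$ is chosen uniformly at random and gives her item to $i_1$ (ceasing to be a bridge agent), starting a chain-segment. The chain-segment advances instantaneously by local search: if the current last agent has an edge to at least one waiting agent not already in the chain-segment, one of these is selected at random, with $H$ agents favored over $E$ agents, is matched by the last agent and becomes the new last agent; this is repeated until the last agent has no edge to a remaining waiting agent. All agents of the chain-segment leave the market, and the last one becomes a bridge agent. The numbers of waiting (non-bridge)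 $H$ and $E$ agents form a positive recurrent continuous-time Markov chain (each edge is examined at most once, so edges may be revealed only when examined). Let $[H_k,E_k]$ be the embedded discrete-time Markov chain obtained by observing the system at arrival epochs (each arrival advances $k$ to $k+1$). The chain-segment length is $L_k=H_k+E_k-H_{k+1}-E_{k+1}+1$, so $L_k=0$ if the arriving agent is not matched by a bridge agent and joins the market, and $L_k\ge1$ is the number of agents in the chain-segment (including the arriving one) otherwise. $L$ is the corresponding random variable in steady-state. *)

theory Defs
  imports "HOL-Probability.Probability"
begin

datatype agent_type = Hard | Easy

(* The first component counts the waiting H agents, the second one the waiting E agents.
   Bridge agents are not part of the state: there are always d of them, and none of them has
   an edge to a waiting agent.  Which compatible bridge agent or which compatible waiting agent of
   a given type is selected is irrelevant for the numbers, since the edges that have not been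
   examined yet are independent of everything revealed so far. *)
type_synonym state = "nat \<times> nat"

(* Reveals n independent potential edges, each present with probability p. *)
definition has_edge :: "nat \<Rightarrow> real \<Rightarrow> bool pmf" where
  "has_edge n p = map_pmf (\<lambda>bs. True \<in> set bs) (replicate_pmf n (bernoulli_pmf p))"

lemma not_has_edge_0 [simp]: "True \<notin> set_pmf (has_edge 0 p)"
  by (simp add: has_edge_def)

(* Local search from the current last agent of a chain-segment, given the numbers of remaining
   waiting agents: None if that agent has no edge to any of them. *)
definition local_search :: "real \<Rightarrow> real \<Rightarrow> state \<Rightarrow> state option pmf" where
  "local_search pH pE s = (case s of (h, e) \<Rightarrow> do {
     toH \<leftarrow> has_edge h pH;
     toE \<leftarrow> has_edge e pE;
     return_pmf (if toH then Some (h - 1, e) else if toE then Some (h, e - 1) else None)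
   })"

lemma local_search_decreases:
  "Some s' \<in> set_pmf (local_search pH pE s) \<Longrightarrow> fst s' + snd s' < fst s + snd s"
  by (cases s; cases "fst s"; cases "snd s") (auto simp: local_search_def split: if_splits)

(* The numbers of waiting agents left when the chain-segment stops. *)
function advance :: "real \<Rightarrow> real \<Rightarrow> state \<Rightarrow> state pmf" where
  "advance pH pE s = do {
     r \<leftarrow> local_search pH pE s;
     (case r of None \<Rightarrow> return_pmf s | Some s' \<Rightarrow> advance pH pE s')
   }"
  by auto
termination
  by (relation "Wellfounded.measure (\<lambda>(pH, pE, s). fst s + snd s)") (auto dest: local_search_decreases)

declare advance.simps [simp del]

fun compat :: "real \<Rightarrow> real \<Rightarrow> agent_type \<Rightarrow> real" where
  "compat pH pE Hard = pH"
| "compat pH pE Easy = pE"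

fun join :: "agent_type \<Rightarrow> state \<Rightarrow> state" where
  "join Hard (h, e) = (Suc h, e)"
| "join Easy (h, e) = (h, Suc e)"

definition arrival :: "nat \<Rightarrow> real \<Rightarrow> real \<Rightarrow> agent_type \<Rightarrow> state \<Rightarrow> state pmf" where
  "arrival d pH pE T s = do {
     bridge \<leftarrow> has_edge d (compat pH pE T);
     (if bridge then advance pH pE s else return_pmf (join T s))
   }"

(* At any time the waiting times until the next H and the next E arrival of the two independent
   Poisson processes are independent and exponentially distributed; the next agent is of type H
   iff the H clock rings first. *)
definition arrival_type :: "real \<Rightarrow> real \<Rightarrow> agent_type pmf" where
  "arrival_type lH lE =
     map_pmf (\<lambda>b. if b then Hard else Easy)
       (bernoulli_pmf
         (measure (density lborel (exponential_density lH) \<Otimes>\<^sub>M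
                   density lborel (exponential_density lE))
                  {(x, y). x < y}))"

(* Transition kernel of the chain [H_k, E_k] embedded at arrival epochs. *)
definition chain_match :: "nat \<Rightarrow> real \<Rightarrow> real \<Rightarrow> real \<Rightarrow> real \<Rightarrow> state \<Rightarrow> state pmf" where
  "chain_match d lH lE pH pE s = do {
     T \<leftarrow> arrival_type lH lE;
     arrival d pH pE T s
   }"

definition stationary :: "('s \<Rightarrow> 's pmf) \<Rightarrow> 's pmf \<Rightarrow> bool" where
  "stationary K \<pi> \<longleftrightarrow> bind_pmf \<pi> K = \<pi>"

(* Only meaningful if there is exactly one stationary distribution.  For chain_match this is
   the case when the arrival rates are positive, d > 0, 0 < pH < 1 and 0 < pE <= 1: the probability
   that the next chain-segment absorbs all waiting agents is bounded below uniformly in the state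
   (Doeblin's condition). *)
definition steady_state :: "('s \<Rightarrow> 's pmf) \<Rightarrow> 's pmf" where
  "steady_state K = (THE \<pi>. stationary K \<pi>)"

definition segment_length :: "state \<Rightarrow> state \<Rightarrow> int" where
  "segment_length s s' =
     int (fst s) + int (snd s) - int (fst s') - int (snd s') + 1"

(* Law of L_k when [H_k, E_k] has the stationary distribution. *)
definition steady_length :: "nat \<Rightarrow> real \<Rightarrow> real \<Rightarrow> real \<Rightarrow> real \<Rightarrow> int pmf" where
  "steady_length d lH lE pH pE = do {
     s \<leftarrow> steady_state (chain_match d lH lE pH pE);
     s' \<leftarrow> chain_match d lH lE pH pE s;
     return_pmf (segment_length s s')
   }"

end

theory Submission
  imports Defs
begin

text \<open>From any state, the next chain-segment absorbs all waiting agents with probability at least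
  some \<open>\<epsilon> > 0\<close>. So the chain regenerates at the empty market, its stationary distribution is unique,
  and the market size, which grows by at most one per arrival, is dominated in steady state by a
  geometric variable and has finite mean. By stationarity this mean cancels in
  \<open>L = S\<^sub>k - S\<^sub>k\<^sub>+\<^sub>1 + 1\<close>, where \<open>S\<close> is the market size, so \<open>E[L] = 1\<close>. Whether an arriving agent is matched
  by a bridge agent does not depend on the state, so \<open>P(L \<ge> 1)\<close> is explicit, and as \<open>L \<ge> 0\<close> the
  conditional expectation is \<open>1 / P(L \<ge> 1)\<close>.\<close>

section \<open>Regeneration under a Doeblin minorization\<close>

text \<open>The residual law is \<open>(p - \<epsilon> * indicator {x}) / (1 - \<epsilon>)\<close>,
  which is nonnegative because the atom at \<open>x\<close> weighs at least
  \<open>\<epsilon>\<close>. The inclusion of supports lets one-step bounds for \<open>p\<close>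
  carry over to the residual law.\<close>

lemma minorized_pmf_mixture:
  fixes p :: "'s pmf"
  assumes "0 < \<epsilon>" "\<epsilon> < 1" "\<epsilon> \<le> pmf p x"
  obtains r where "set_pmf r \<subseteq> set_pmf p"
    and "p = bind_pmf (bernoulli_pmf \<epsilon>) (\<lambda>b. if b then return_pmf x else r)"
proof -
  define f where "f y = (pmf p y - \<epsilon> * indicator {x} y) / (1 - \<epsilon>)" for y
  have nonneg: "0 \<le> f y" for y
    using assms by (auto simp: f_def indicator_def)
  have split: "ennreal (pmf p y) = ennreal (1 - \<epsilon>) * ennreal (f y) + ennreal \<epsilon> * indicator {x} y" for y
  proof -
    have "pmf p y = (1 - \<epsilon>) * f y + \<epsilon> * indicator {x} y"
      using assms by (simp add: f_def)
    then show ?thesis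
      using assms nonneg[of y]
      by (simp add: ennreal_mult ennreal_plus flip: ennreal_indicator)
  qed
  have "1 = (\<integral>\<^sup>+y. ennreal (pmf p y) \<partial>count_space UNIV)"
    by (simp add: nn_integral_pmf)
  also have "\<dots> = ennreal (1 - \<epsilon>) * (\<integral>\<^sup>+y. ennreal (f y) \<partial>count_space UNIV) + ennreal \<epsilon>"
    unfolding split by (simp add: nn_integral_add nn_integral_cmult nn_integral_cmult_indicator)
  finally have total: "1 = ennreal (1 - \<epsilon>) * (\<integral>\<^sup>+y. ennreal (f y) \<partial>count_space UNIV) + ennreal \<epsilon>" .
  \<comment> \<open>Cancelling \<open>\<epsilon>\<close> and \<open>1 - \<epsilon>\<close> in
    \<open>total\<close> needs real numbers, so an infinite integral is excluded separately.\<close>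
  have prob: "(\<integral>\<^sup>+y. ennreal (f y) \<partial>count_space UNIV) = 1"
  proof (cases "\<integral>\<^sup>+y. ennreal (f y) \<partial>count_space UNIV")
    case (real r)
    then have "ennreal 1 = ennreal ((1 - \<epsilon>) * r + \<epsilon>)"
      using total assms by (simp add: ennreal_mult ennreal_plus)
    then have "1 = (1 - \<epsilon>) * r + \<epsilon>"
      using assms real by (subst (asm) ennreal_inj) auto
    then have "(1 - \<epsilon>) * (r - 1) = 0"
      by (simp add: algebra_simps)
    then show ?thesis
      using real assms by simp
  next
    case top
    then show ?thesis
      using total assms by (simp add: ennreal_mult_top)
  qed
  let ?r = "embed_pmf f"
  have pmf_r: "pmf ?r y = f y" for y
    by (rule pmf_embed_pmf[OF nonneg prob])
  show thesis
  proof
    show "set_pmf ?r \<subseteq> set_pmf p"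
      using assms by (auto simp: set_pmf_iff pmf_r f_def indicator_def split: if_splits)
    show "p = bind_pmf (bernoulli_pmf \<epsilon>) (\<lambda>b. if b then return_pmf x else ?r)"
      using assms by (intro pmf_eqI) (simp add: pmf_bind pmf_r f_def indicator_def)
  qed
qed

text \<open>For the residual kernel \<open>R\<close>, this is the law \<open>n\<close> steps after a
  regeneration at \<open>x\<close>, given that no other has occurred since.\<close>

primrec kernel_power :: "nat \<Rightarrow> ('s \<Rightarrow> 's pmf) \<Rightarrow> 's \<Rightarrow> 's pmf" where
  "kernel_power 0 R x = return_pmf x"
| "kernel_power (Suc n) R x = bind_pmf (kernel_power n R x) R"

context
  fixes K :: "'s \<Rightarrow> 's pmf" and R :: "'s \<Rightarrow> 's pmf" and \<epsilon> :: real and x :: 's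
  assumes eps: "0 < \<epsilon>" "\<epsilon> < 1"
    and support: "\<And>s. set_pmf (R s) \<subseteq> set_pmf (K s)"
    and mixture: "\<And>s. K s = bind_pmf (bernoulli_pmf \<epsilon>) (\<lambda>b. if b then return_pmf x else R s)"
begin

text \<open>The regeneration coin does not depend on the state, so it may be tossed before the state
  is drawn.\<close>

lemma bind_mixture:
  "bind_pmf \<mu> K = bind_pmf (bernoulli_pmf \<epsilon>) (\<lambda>b. if b then return_pmf x else bind_pmf \<mu> R)"
proof -
  have "bind_pmf \<mu> K =
      bind_pmf (bernoulli_pmf \<epsilon>) (\<lambda>b. bind_pmf \<mu> (\<lambda>s. if b then return_pmf x else R s))"
    unfolding mixture by (rule bind_commute_pmf)
  also have "\<dots> = bind_pmf (bernoulli_pmf \<epsilon>) (\<lambda>b. if b then return_pmf x else bind_pmf \<mu> R)"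
    by (intro bind_pmf_cong) auto
  finally show ?thesis .
qed

text \<open>A stationary law is unfolded by one step: on regeneration both laws restart at
  \<open>x\<close> and their contributions cancel, and otherwise the same difference remains with
  \<open>R\<close> put in front of \<open>G\<close>. The kernel \<open>G\<close> is kept arbitrary
  so that the induction can absorb these copies of \<open>R\<close>.\<close>

lemma stationary_contraction:
  fixes G :: "'s \<Rightarrow> 't pmf"
  assumes "stationary K \<mu>" "stationary K \<nu>"
  shows "\<bar>pmf (bind_pmf \<mu> G) y - pmf (bind_pmf \<nu> G) y\<bar> \<le> (1 - \<epsilon>) ^ n"
proof (induction n arbitrary: G)
  case 0
  show ?case
    using pmf_le_1[of "bind_pmf \<mu> G" y] pmf_le_1[of "bind_pmf \<nu> G" y]
      pmf_nonneg[of "bind_pmf \<mu> G" y] pmf_nonneg[of "bind_pmf \<nu> G" y]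
    unfolding power_0 abs_le_iff by linarith
next
  case (Suc n)
  have unfold: "pmf (bind_pmf \<kappa> G) y =
      \<epsilon> * pmf (G x) y + (1 - \<epsilon>) * pmf (bind_pmf \<kappa> (\<lambda>s. bind_pmf (R s) G)) y"
    if "stationary K \<kappa>" for \<kappa>
  proof -
    have "\<kappa> = bind_pmf (bernoulli_pmf \<epsilon>) (\<lambda>b. if b then return_pmf x else bind_pmf \<kappa> R)"
      using that bind_mixture[of \<kappa>] by (simp add: stationary_def)
    then have "bind_pmf \<kappa> G = bind_pmf (bernoulli_pmf \<epsilon>)
        (\<lambda>b. bind_pmf (if b then return_pmf x else bind_pmf \<kappa> R) G)"
      by (metis bind_assoc_pmf)
    then have "pmf (bind_pmf \<kappa> G) y =
        \<epsilon> * pmf (G x) y + (1 - \<epsilon>) * pmf (bind_pmf (bind_pmf \<kappa> R) G) y"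
      using eps by (simp add: pmf_bind[of "bernoulli_pmf \<epsilon>"] bind_return_pmf)
    then show ?thesis
      by (simp add: bind_assoc_pmf)
  qed
  have "\<bar>pmf (bind_pmf \<mu> G) y - pmf (bind_pmf \<nu> G) y\<bar> =
      (1 - \<epsilon>) * \<bar>pmf (bind_pmf \<mu> (\<lambda>s. bind_pmf (R s) G)) y
        - pmf (bind_pmf \<nu> (\<lambda>s. bind_pmf (R s) G)) y\<bar>"
    using eps unfolding unfold[OF assms(1)] unfold[OF assms(2)]
    by (simp add: abs_mult flip: right_diff_distrib)
  then show ?case
    using Suc eps by (simp add: mult_left_mono)
qed

lemma mixture_stationary_unique:
  assumes "stationary K \<mu>" "stationary K \<nu>"
  shows "\<mu> = \<nu>"
proof (rule pmf_eqI)
  fix y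
  have "(\<lambda>n. (1 - \<epsilon>) ^ n) \<longlonglongrightarrow> 0"
    using eps by (intro LIMSEQ_power_zero) auto
  moreover have "\<bar>pmf \<mu> y - pmf \<nu> y\<bar> \<le> (1 - \<epsilon>) ^ n" for n
    using stationary_contraction[OF assms, of return_pmf y n] by (simp add: bind_return_pmf')
  ultimately have "\<bar>pmf \<mu> y - pmf \<nu> y\<bar> \<le> 0"
    by (intro LIMSEQ_le_const) auto
  then show "pmf \<mu> y = pmf \<nu> y"
    by simp
qed

text \<open>Looking back from the present, the number of steps since the last regeneration at \<open>x\<close> is
  geometrically distributed.\<close>

lemma mixture_stationary_regenerative:
  "stationary K (bind_pmf (geometric_pmf \<epsilon>) (\<lambda>n. kernel_power n R x))" (is "stationary K ?\<pi>")
proof -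
  have "?\<pi> = bind_pmf (bernoulli_pmf \<epsilon>) (\<lambda>b. bind_pmf
      (if b then return_pmf 0 else map_pmf Suc (geometric_pmf \<epsilon>)) (\<lambda>n. kernel_power n R x))"
    using eps by (subst geometric_bind_pmf_unfold) (auto simp: bind_assoc_pmf)
  also have "\<dots> = bind_pmf (bernoulli_pmf \<epsilon>) (\<lambda>b. if b then return_pmf x else bind_pmf ?\<pi> R)"
    by (intro bind_pmf_cong) (auto simp: bind_return_pmf bind_map_pmf bind_assoc_pmf)
  also have "\<dots> = bind_pmf ?\<pi> K"
    by (rule bind_mixture[symmetric])
  finally show ?thesis
    by (simp add: stationary_def)
qed

lemma kernel_power_growth:
  fixes f :: "'s \<Rightarrow> real"
  assumes "\<And>s s'. s' \<in> set_pmf (K s) \<Longrightarrow> f s' \<le> f s + 1"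
  shows "y \<in> set_pmf (kernel_power n R x) \<Longrightarrow> f y \<le> f x + real n"
proof (induction n arbitrary: y)
  case (Suc n)
  then obtain z where "z \<in> set_pmf (kernel_power n R x)" "y \<in> set_pmf (R z)"
    by auto
  then show ?case
    using Suc.IH[of z] assms[of y z] support by fastforce
qed auto

text \<open>Given \<open>n\<close> steps since the last regeneration, \<open>f\<close> is at most
  \<open>f x + n\<close>, and a geometric variable has finite mean.\<close>

lemma mixture_stationary_integrable:
  fixes f :: "'s \<Rightarrow> real"
  assumes step: "\<And>s s'. s' \<in> set_pmf (K s) \<Longrightarrow> f s' \<le> f s + 1"
    and nonneg: "\<And>s. 0 \<le> f s"
  shows "integrable (bind_pmf (geometric_pmf \<epsilon>) (\<lambda>n. kernel_power n R x)) f"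
    (is "integrable (measure_pmf ?\<pi>) f")
proof (rule integrableI_bounded)
  have "(\<integral>\<^sup>+y. ennreal (norm (f y)) \<partial>?\<pi>) \<le> (\<integral>\<^sup>+n. ennreal (f x + real n) \<partial>geometric_pmf \<epsilon>)"
  proof (simp, rule nn_integral_mono)
    fix n
    have "(\<integral>\<^sup>+y. ennreal \<bar>f y\<bar> \<partial>kernel_power n R x) \<le>
        (\<integral>\<^sup>+y. ennreal (f x + real n) \<partial>kernel_power n R x)"
      using kernel_power_growth[of f, OF step] nonneg
      by (intro nn_integral_mono_AE) (simp add: AE_measure_pmf_iff ennreal_leI del: ennreal_plus)
    then show "(\<integral>\<^sup>+y. ennreal \<bar>f y\<bar> \<partial>kernel_power n R x) \<le> ennreal (f x + real n)"
      by simp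
  qed
  also have "\<dots> < \<infinity>"
  proof -
    have "integrable (geometric_pmf \<epsilon>) (\<lambda>n. f x + real n)"
      using eps by (intro Bochner_Integration.integrable_add integrable_real_geometric_pmf) auto
    then show ?thesis
      using nonneg by (subst nn_integral_eq_integral) auto
  qed
  finally show "(\<integral>\<^sup>+y. ennreal (norm (f y)) \<partial>?\<pi>) < \<infinity>" .
qed simp

end

lemma steady_state_of_minorized:
  fixes K :: "'s \<Rightarrow> 's pmf"
  assumes eps: "0 < \<epsilon>" and minor: "\<And>s. \<epsilon> \<le> pmf (K s) x"
    and step: "\<And>s s'. s' \<in> set_pmf (K s) \<Longrightarrow> f s' \<le> f s + 1"
    and nonneg: "\<And>s. 0 \<le> (f s :: real)"
  shows "bind_pmf (steady_state K) K = steady_state K"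
    and "integrable (measure_pmf (steady_state K)) f"
proof -
  \<comment> \<open>The cap at 1/2 keeps \<open>\<delta>\<close> strictly below 1, as the division
    by \<open>1 - \<delta>\<close> in the residual law demands.\<close>
  define \<delta> where "\<delta> = min \<epsilon> (1 / 2)"
  have delta: "0 < \<delta>" "\<delta> < 1"
    using eps by (auto simp: \<delta>_def)
  have "\<exists>r. set_pmf r \<subseteq> set_pmf (K s) \<and>
      K s = bind_pmf (bernoulli_pmf \<delta>) (\<lambda>b. if b then return_pmf x else r)" for s
  proof -
    have "\<delta> \<le> pmf (K s) x"
      using minor[of s] by (simp add: \<delta>_def)
    then show ?thesis
      using minorized_pmf_mixture[OF delta] by metis
  qed
  then obtain R where R: "\<And>s. set_pmf (R s) \<subseteq> set_pmf (K s)"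
      "\<And>s. K s = bind_pmf (bernoulli_pmf \<delta>) (\<lambda>b. if b then return_pmf x else R s)"
    by metis
  let ?\<pi> = "bind_pmf (geometric_pmf \<delta>) (\<lambda>n. kernel_power n R x)"
  have stat: "stationary K ?\<pi>"
    by (rule mixture_stationary_regenerative[OF delta R])
  have steady: "steady_state K = ?\<pi>"
    unfolding steady_state_def
  proof (rule the_equality)
    show "stationary K ?\<pi>"
      by (rule stat)
    show "\<mu> = ?\<pi>" if "stationary K \<mu>" for \<mu>
      by (rule mixture_stationary_unique[OF delta R that stat])
  qed
  show "bind_pmf (steady_state K) K = steady_state K"
      "integrable (measure_pmf (steady_state K)) f"
    unfolding steady using stat mixture_stationary_integrable[OF delta R step nonneg]
    by (simp_all only: stationary_def)
qed

section \<open>Lower bounds for emptying the market\<close>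

text \<open>Keeping only one intermediate value bounds the probability from below; iterated, this
  bounds it by the weight of a single path.\<close>

lemma pmf_bind_ge: "pmf p x * pmf (f x) y \<le> pmf (bind_pmf p f) y"
proof -
  have "pmf p x * pmf (f x) y = (\<integral>z. indicator {x} z * pmf (f x) y \<partial>p)"
    by (simp add: measure_pmf_single)
  also have "\<dots> \<le> (\<integral>z. pmf (f z) y \<partial>p)"
    by (intro integral_mono measure_pmf.integrable_const_bound[where B = 1])
       (auto simp: indicator_def pmf_le_1)
  finally show ?thesis
    by (simp add: pmf_bind)
qed

lemma has_edge_Suc:
  "has_edge (Suc n) p = bind_pmf (bernoulli_pmf p) (\<lambda>b. if b then return_pmf True else has_edge n p)"
  unfolding has_edge_def replicate_pmf.simps map_bind_pmf
  by (intro bind_pmf_cong) (auto simp: map_pmf_def bind_assoc_pmf bind_return_pmf)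

lemma has_edge_0: "has_edge 0 p = return_pmf False"
  by (simp add: has_edge_def)

lemma pmf_has_edge_True:
  assumes "0 \<le> p" "p \<le> 1"
  shows "pmf (has_edge n p) True = 1 - (1 - p) ^ n"
proof (induction n)
  case (Suc n)
  then have "pmf (has_edge (Suc n) p) True = p + (1 - (1 - p) ^ n) * (1 - p)"
    using assms by (simp add: has_edge_Suc pmf_bind)
  then show ?case
    by (simp add: algebra_simps)
qed (simp add: has_edge_0)

lemma advance_le: "s' \<in> set_pmf (advance pH pE s) \<Longrightarrow> fst s' + snd s' \<le> fst s + snd s"
proof (induction pH pE s arbitrary: s' rule: advance.induct)
  case (1 pH pE s)
  from "1.prems" obtain r where r: "r \<in> set_pmf (local_search pH pE s)"
    "s' \<in> set_pmf (case r of None \<Rightarrow> return_pmf s | Some t \<Rightarrow> advance pH pE t)"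
    unfolding advance.simps[of pH pE s] by auto
  show ?case
  proof (cases r)
    case None
    then show ?thesis using r by simp
  next
    case (Some t)
    then have "fst s' + snd s' \<le> fst t + snd t"
      using r "1.IH"[of r t s'] by simp
    then show ?thesis
      using local_search_decreases[of t pH pE s] r Some by simp
  qed
qed

lemma advance_step_ge:
  "pmf (local_search pH pE s) (Some s') * pmf (advance pH pE s') t \<le> pmf (advance pH pE s) t"
  unfolding advance.simps[of pH pE s]
  using pmf_bind_ge[of "local_search pH pE s" "Some s'"
      "\<lambda>r. case r of None \<Rightarrow> return_pmf s | Some s' \<Rightarrow> advance pH pE s'" t]
  by simp

text \<open>Since H agents are favored, one edge to an H agent decides the step whatever the E edges
  are.\<close>

lemma local_search_Hard:
  assumes "0 \<le> pH" "pH \<le> 1"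
  shows "1 - (1 - pH) ^ Suc h \<le> pmf (local_search pH pE (Suc h, e)) (Some (h, e))"
  using pmf_bind_ge[of "has_edge (Suc h) pH" True
      "\<lambda>toH. bind_pmf (has_edge e pE) (\<lambda>toE. return_pmf
        (if toH then Some (Suc h - 1, e) else if toE then Some (Suc h, e - 1) else None))"
      "Some (h, e)"] assms
  by (simp add: local_search_def pmf_has_edge_True)

lemma local_search_Easy:
  assumes "0 \<le> pE" "pE \<le> 1"
  shows "1 - (1 - pE) ^ Suc e \<le> pmf (local_search pH pE (0, Suc e)) (Some (0, e))"
  using pmf_bind_ge[of "has_edge (Suc e) pE" True
      "\<lambda>toE. return_pmf (if toE then Some (0, Suc e - 1) else None)" "Some (0, e)"] assms
  by (simp add: local_search_def pmf_has_edge_True has_edge_0 bind_return_pmf)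

lemma advance_empty: "advance pH pE (0, 0) = return_pmf (0, 0)"
  by (simp add: advance.simps local_search_def has_edge_0 bind_return_pmf)

text \<open>Weight of the path that absorbs all H agents and then all E agents. This order agrees
  with the priority rule, so each factor involves one type only: the outer induction removes H
  agents, the inner one treats a market of E agents alone.\<close>

lemma advance_exhaust_ge:
  assumes "0 \<le> pH" "pH \<le> 1" "0 \<le> pE" "pE \<le> 1"
  shows "(\<Prod>k<h. 1 - (1 - pH) ^ Suc k) * (\<Prod>k<e. 1 - (1 - pE) ^ Suc k)
    \<le> pmf (advance pH pE (h, e)) (0, 0)"
proof (induction h)
  case 0
  show ?case
  proof (induction e)
    case 0
    show ?case by (simp add: advance_empty)
  next
    case (Suc e)
    have "(\<Prod>k<Suc e. 1 - (1 - pE) ^ Suc k) =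
        (1 - (1 - pE) ^ Suc e) * (\<Prod>k<e. 1 - (1 - pE) ^ Suc k)"
      by (simp add: mult.commute)
    also have "\<dots> \<le> pmf (local_search pH pE (0, Suc e)) (Some (0, e)) * pmf (advance pH pE (0, e)) (0, 0)"
      using Suc assms
      by (intro mult_mono local_search_Easy prod_nonneg) (auto intro!: power_le_one mult_le_one)
    also have "\<dots> \<le> pmf (advance pH pE (0, Suc e)) (0, 0)"
      by (rule advance_step_ge)
    finally show ?case by simp
  qed
next
  case (Suc h)
  have "(\<Prod>k<Suc h. 1 - (1 - pH) ^ Suc k) * (\<Prod>k<e. 1 - (1 - pE) ^ Suc k) =
      (1 - (1 - pH) ^ Suc h) * ((\<Prod>k<h. 1 - (1 - pH) ^ Suc k) * (\<Prod>k<e. 1 - (1 - pE) ^ Suc k))"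
    by (simp add: mult_ac)
  also have "\<dots> \<le> pmf (local_search pH pE (Suc h, e)) (Some (h, e)) * pmf (advance pH pE (h, e)) (0, 0)"
    using Suc assms
    by (intro mult_mono local_search_Hard mult_nonneg_nonneg prod_nonneg)
       (auto intro!: power_le_one mult_le_one)
  also have "\<dots> \<le> pmf (advance pH pE (Suc h, e)) (0, 0)"
    by (rule advance_step_ge)
  finally show ?case .
qed

text \<open>The partial products decrease to an infinite product, which is positive because the
  geometric series converges and no factor vanishes. This limit serves as \<open>c\<close>, and
  makes the later bound uniform over all states.\<close>

lemma prod_one_minus_power_bounded_below:
  fixes x :: real
  assumes "0 \<le> x" "x < 1"
  obtains c where "0 < c" "\<And>n. c \<le> (\<Prod>k<n. 1 - x ^ Suc k)"
proof -
  define P where "P n = (\<Prod>k<n. 1 - x ^ Suc k)" for n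
  have factor: "0 < 1 - x ^ Suc k" "1 - x ^ Suc k \<le> 1" for k
    using assms by (auto simp: power_less_one_iff simp del: power_Suc)
  have "summable (\<lambda>k. norm (- (x ^ Suc k)))"
    using assms by (simp add: summable_geometric summable_mult abs_mult power_abs)
  then have "convergent_prod (\<lambda>k. 1 + - (x ^ Suc k))"
    by (intro abs_convergent_prod_imp_convergent_prod summable_imp_abs_convergent_prod) simp
  then have conv: "convergent_prod (\<lambda>k. 1 - x ^ Suc k)"
    by simp
  then have lim: "(\<lambda>n. \<Prod>k\<le>n. 1 - x ^ Suc k) \<longlonglongrightarrow> prodinf (\<lambda>k. 1 - x ^ Suc k)"
    by (rule convergent_prod_LIMSEQ)
  \<comment> \<open>The previous limit runs over \<open>{..n}\<close>, whereas \<open>P n\<close>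
    multiplies over \<open>{..<n}\<close>; hence the index shift.\<close>
  then have lim: "P \<longlonglongrightarrow> prodinf (\<lambda>k. 1 - x ^ Suc k)"
    unfolding P_def by (subst (asm) lessThan_Suc_atMost[symmetric]) (rule LIMSEQ_imp_Suc)
  have dec: "decseq P"
    unfolding P_def
    using factor by (intro decseq_SucI) (simp add: prod_nonneg less_imp_le mult_left_le del: power_Suc)
  have "0 \<le> prodinf (\<lambda>k. 1 - x ^ Suc k)"
  proof (rule LIMSEQ_le_const[OF lim], intro exI allI impI)
    show "0 \<le> P n" for n
      unfolding P_def by (intro prod_nonneg less_imp_le factor)
  qed
  moreover have "prodinf (\<lambda>k. 1 - x ^ Suc k) \<noteq> 0"
    using conv factor(1) by (intro prodinf_nonzero) (auto simp del: power_Suc simp: less_imp_neq[symmetric])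
  ultimately have "0 < prodinf (\<lambda>k. 1 - x ^ Suc k)"
    by linarith
  then show thesis
    by (rule that) (use decseq_ge[OF dec lim] in \<open>simp only: P_def\<close>)
qed

section \<open>The race of two exponential clocks\<close>

lemma exponential_tail:
  assumes "0 < l" "0 \<le> a"
  shows "emeasure (density lborel (exponential_density l)) {a<..} = ennreal (exp (- a * l))"
proof -
  interpret prob_space "density lborel (exponential_density l)"
    by (rule prob_space_exponential_density[OF assms(1)])
  have "distributed (density lborel (exponential_density l)) lborel (\<lambda>x. x) (exponential_density l)"
    using assms(1) by (auto simp: distributed_def distr_id2 exponential_density_nonneg)
  then have "prob {x \<in> space (density lborel (exponential_density l)). a < x} = exp (- a * l)"
    by (rule exponential_distributedD_gt) fact+
  moreover have "{x. a < x} = {a<..}"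
    by auto
  ultimately show ?thesis
    by (simp add: emeasure_eq_measure)
qed

text \<open>Condition on the first clock ringing at \<open>x\<close>: its density times the tail of
  the second clock beyond \<open>x\<close> is \<open>l / (l + m)\<close> times the exponential
  density of rate \<open>l + m\<close>, which has total mass 1.\<close>

lemma exponential_race:
  assumes l: "0 < l" and m: "0 < m"
  shows "measure (density lborel (exponential_density l) \<Otimes>\<^sub>M density lborel (exponential_density m))
    {(x, y). x < y} = l / (l + m)"
proof -
  let ?L = "density lborel (exponential_density l)" and ?M = "density lborel (exponential_density m)"
  interpret M: prob_space ?M
    by (rule prob_space_exponential_density[OF m])
  interpret S: prob_space "density lborel (exponential_density (l + m))"
    using l m by (intro prob_space_exponential_density) simp
  have meas: "{(x, y). x < y} \<in> sets (?L \<Otimes>\<^sub>M ?M)"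
  proof -
    have "{z \<in> space (borel \<Otimes>\<^sub>M borel). fst z < (snd z :: real)} \<in> sets (borel \<Otimes>\<^sub>M borel)"
      by measurable
    moreover have "sets (?L \<Otimes>\<^sub>M ?M) = sets (borel \<Otimes>\<^sub>M borel)"
      by (intro sets_pair_measure_cong) auto
    ultimately show ?thesis
      by (simp add: space_pair_measure case_prod_unfold)
  qed
  have pointwise: "ennreal (exponential_density l x) * emeasure ?M {x<..} =
      ennreal (l / (l + m)) * ennreal (exponential_density (l + m) x)" for x
  proof (cases "x < 0")
    case False
    have "exponential_density l x * exp (- x * m) = l / (l + m) * exponential_density (l + m) x"
      using l m False by (simp add: exponential_density_def field_simps flip: exp_add)
    then show ?thesis
      using l m False exponential_density_nonneg[of l x]
      by (simp add: exponential_tail flip: ennreal_mult')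
  qed (simp add: exponential_density_def)
  have slice: "Pair x -` {(x, y). x < y} = {x<..}" for x :: real
    by auto
  have "emeasure (?L \<Otimes>\<^sub>M ?M) {(x, y). x < y} = (\<integral>\<^sup>+x. emeasure ?M {x<..} \<partial>?L)"
    by (simp only: M.emeasure_pair_measure_alt[OF meas] slice)
  also have "\<dots> = (\<integral>\<^sup>+x. ennreal (exponential_density l x) * emeasure ?M {x<..} \<partial>lborel)"
    using M.measurable_emeasure_Pair[OF meas] unfolding slice by (subst nn_integral_density) auto
  also have "\<dots> = ennreal (l / (l + m)) * (\<integral>\<^sup>+x. ennreal (exponential_density (l + m) x) \<partial>lborel)"
    unfolding pointwise by (rule nn_integral_cmult) simp
  also have "(\<integral>\<^sup>+x. ennreal (exponential_density (l + m) x) \<partial>lborel) = 1"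
    using S.emeasure_space_1 by (simp add: emeasure_density)
  finally show ?thesis
    using l m by (simp add: measure_def)
qed

lemma arrival_type_bernoulli:
  assumes "0 < lH" "0 < lE"
  shows "arrival_type lH lE =
    map_pmf (\<lambda>b. if b then Hard else Easy) (bernoulli_pmf (lH / (lH + lE)))"
  using assms by (simp add: arrival_type_def exponential_race)

section \<open>The chain-segment length in steady state\<close>

lemma segment_length_join: "segment_length s (join T s) = 0"
  by (cases T; cases s) (simp_all add: segment_length_def)

definition match_prob :: "nat \<Rightarrow> real \<Rightarrow> real \<Rightarrow> real \<Rightarrow> real \<Rightarrow> real" where
  "match_prob d lH lE pH pE =
     (lH * (1 - (1 - pH) ^ d) + lE * (1 - (1 - pE) ^ d)) / (lH + lE)"

locale chain_match_model =
  fixes d :: nat and lH lE pH pE :: real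
  assumes lH: "0 < lH" and lE: "0 < lE" and pH: "0 < pH" "pH < 1" and pE: "0 < pE" "pE \<le> 1"
    and d: "1 \<le> d"
begin

abbreviation "K \<equiv> chain_match d lH lE pH pE"
abbreviation "\<pi> \<equiv> steady_state K"

text \<open>A chain-segment never enlarges the market, so the final \<open>+ 1\<close> for the
  arriving agent gives length at least 1; an agent who joins cancels that \<open>+ 1\<close>. The
  outcome of the bridge search can thus be read off the length.\<close>

lemma segment_length_arrival:
  assumes "s' \<in> set_pmf (if bridge then advance pH pE s else return_pmf (join T s))"
  shows "0 \<le> segment_length s s'" "1 \<le> segment_length s s' \<longleftrightarrow> bridge"
proof -
  have "1 \<le> segment_length s s'" if bridge
    using that assms advance_le[of s' pH pE s] by (simp add: segment_length_def)
  moreover have "segment_length s s' = 0" if "\<not> bridge"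
    using that assms by (simp add: segment_length_join)
  ultimately show "0 \<le> segment_length s s'" "1 \<le> segment_length s s' \<longleftrightarrow> bridge"
    by (cases bridge; simp)+
qed

lemma segment_length_nonneg: "s' \<in> set_pmf (K s) \<Longrightarrow> 0 \<le> segment_length s s'"
  unfolding chain_match_def arrival_def set_bind_pmf
  by (elim UN_E) (rule segment_length_arrival(1))

text \<open>One favorable scenario suffices: an E agent arrives, some bridge agent has an edge to
  her, and the segment absorbs everybody. None of the three bounds \<open>?E\<close>,
  \<open>?B\<close>, \<open>a * b\<close> depends on the state.\<close>

lemma minorization: obtains \<epsilon> where "0 < \<epsilon>" "\<And>s. \<epsilon> \<le> pmf (K s) (0, 0)"
proof -
  obtain a where a: "0 < a" "\<And>n. a \<le> (\<Prod>k<n. 1 - (1 - pH) ^ Suc k)"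
    using prod_one_minus_power_bounded_below[of "1 - pH"] pH by auto
  obtain b where b: "0 < b" "\<And>n. b \<le> (\<Prod>k<n. 1 - (1 - pE) ^ Suc k)"
    using prod_one_minus_power_bounded_below[of "1 - pE"] pE by auto
  let ?E = "pmf (arrival_type lH lE) Easy" and ?B = "pmf (has_edge d pE) True"
  have "?E = lE / (lH + lE)"
  proof -
    have "(\<lambda>b. if b then Hard else Easy) -` {Easy} = {False}"
      by auto
    then show ?thesis
      using lH lE by (simp add: arrival_type_bernoulli pmf_map measure_pmf_single field_simps)
  qed
  then have E: "0 < ?E"
    using lH lE by simp
  have B: "0 < ?B"
    using pE d by (simp add: pmf_has_edge_True power_less_one_iff)
  have "?E * (?B * (a * b)) \<le> pmf (K s) (0, 0)" for s
  proof -
    obtain h e where s: "s = (h, e)"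
      by (cases s)
    have "a * b \<le> (\<Prod>k<h. 1 - (1 - pH) ^ Suc k) * (\<Prod>k<e. 1 - (1 - pE) ^ Suc k)"
      using a b by (intro mult_mono) (auto intro: order_trans[OF less_imp_le])
    also have "\<dots> \<le> pmf (advance pH pE s) (0, 0)"
      unfolding s using pH pE by (intro advance_exhaust_ge) auto
    finally have "?B * (a * b) \<le> ?B * pmf (advance pH pE s) (0, 0)"
      by (simp add: mult_left_mono)
    also have "\<dots> \<le> pmf (arrival d pH pE Easy s) (0, 0)"
      using pmf_bind_ge[of "has_edge d pE" True
          "\<lambda>bridge. if bridge then advance pH pE s else return_pmf (join Easy s)" "(0, 0)"]
      by (simp add: arrival_def)
    finally have "?E * (?B * (a * b)) \<le> ?E * pmf (arrival d pH pE Easy s) (0, 0)"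
      by (simp add: mult_left_mono)
    also have "\<dots> \<le> pmf (K s) (0, 0)"
      unfolding chain_match_def by (rule pmf_bind_ge)
    finally show ?thesis .
  qed
  then show thesis
    using that[of "?E * (?B * (a * b))"] E B a b by simp
qed

lemma stationary_steady_state: "bind_pmf \<pi> K = \<pi>"
  and integrable_market_size: "integrable (measure_pmf \<pi>) (\<lambda>s. real (fst s + snd s))"
proof -
  obtain \<epsilon> where eps: "0 < \<epsilon>" "\<And>s. \<epsilon> \<le> pmf (K s) (0, 0)"
    using minorization by metis
  \<comment> \<open>Nonnegativity of the segment length says exactly that the market grows by at
    most one per arrival.\<close>
  have step: "real (fst s' + snd s') \<le> real (fst s + snd s) + 1" if "s' \<in> set_pmf (K s)" for s s'
    using segment_length_nonneg[OF that] by (simp add: segment_length_def)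
  show "bind_pmf \<pi> K = \<pi>"
    by (rule steady_state_of_minorized(1)[OF eps step]) simp_all
  show "integrable (measure_pmf \<pi>) (\<lambda>s. real (fst s + snd s))"
    by (rule steady_state_of_minorized(2)[OF eps step]) simp_all
qed

abbreviation "L \<equiv> steady_length d lH lE pH pE"

lemma steady_length_nonneg: "l \<in> set_pmf L \<Longrightarrow> 0 \<le> l"
  by (auto simp: steady_length_def segment_length_nonneg)

lemma steady_length_expectation: "measure_pmf.expectation L real_of_int = 1"
proof -
  \<comment> \<open>The joint law of two successive states. Both marginals are \<open>\<pi>\<close>,
    the second by stationarity, and integrability allows the expectation of the difference of sizes
    to be split.\<close>
  let ?J = "bind_pmf \<pi> (\<lambda>s. map_pmf (Pair s) (K s))"
  have fst: "map_pmf fst ?J = \<pi>"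
    by (simp add: map_bind_pmf pmf.map_comp o_def bind_return_pmf')
  have snd: "map_pmf snd ?J = \<pi>"
    by (simp add: map_bind_pmf pmf.map_comp o_def stationary_steady_state)
  have L: "L = map_pmf (\<lambda>(s, s'). segment_length s s') ?J"
    by (simp add: steady_length_def map_bind_pmf pmf.map_comp o_def map_pmf_def bind_assoc_pmf bind_return_pmf)
  let ?f = "\<lambda>s. real (fst s + snd s)"
  have int: "integrable (measure_pmf ?J) (\<lambda>z. ?f (fst z))" "integrable (measure_pmf ?J) (\<lambda>z. ?f (snd z))"
    using integrable_market_size integrable_map_pmf_eq[of fst ?J ?f] integrable_map_pmf_eq[of snd ?J ?f]
    unfolding fst snd by simp_all
  have mean: "(\<integral>z. ?f (fst z) \<partial>?J) = (\<integral>s. ?f s \<partial>\<pi>)" "(\<integral>z. ?f (snd z) \<partial>?J) = (\<integral>s. ?f s \<partial>\<pi>)"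
    using integral_map_pmf[of fst ?J ?f] integral_map_pmf[of snd ?J ?f]
    unfolding fst snd by simp_all
  have eq: "real_of_int (case z of (s, s') \<Rightarrow> segment_length s s') = ?f (fst z) - ?f (snd z) + 1" for z
    by (cases z) (simp add: segment_length_def)
  show "measure_pmf.expectation L real_of_int = 1"
    unfolding L integral_map_pmf eq using int mean by simp
qed

text \<open>Reduced to the event \<open>1 \<le> l\<close>, an arrival is just the search among
  \<open>d\<close> bridge edges. The state disappears, so \<open>\<pi>\<close> drops out and only
  the average over the arriving type is left.\<close>

lemma pmf_matched: "pmf (map_pmf (\<lambda>l. 1 \<le> l) L) True = match_prob d lH lE pH pE"
proof -
  have arr: "map_pmf (\<lambda>s'. 1 \<le> segment_length s s') (arrival d pH pE T s) =
      has_edge d (compat pH pE T)" for s T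
  proof -
    have "map_pmf (\<lambda>s'. 1 \<le> segment_length s s')
        (if bridge then advance pH pE s else return_pmf (join T s)) = return_pmf bridge" for bridge
    proof -
      have "map_pmf (\<lambda>s'. 1 \<le> segment_length s s')
          (if bridge then advance pH pE s else return_pmf (join T s)) =
        map_pmf (\<lambda>_. bridge) (if bridge then advance pH pE s else return_pmf (join T s))"
        by (rule pmf.map_cong0) (rule segment_length_arrival(2))
      then show ?thesis
        by (simp add: map_pmf_const)
    qed
    then show ?thesis
      by (simp add: arrival_def map_bind_pmf bind_return_pmf')
  qed
  have "map_pmf (\<lambda>l. 1 \<le> l) L =
      bind_pmf \<pi> (\<lambda>s. bind_pmf (arrival_type lH lE)
        (\<lambda>T. map_pmf (\<lambda>s'. 1 \<le> segment_length s s') (arrival d pH pE T s)))"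
    by (simp add: steady_length_def chain_match_def map_bind_pmf map_pmf_def bind_assoc_pmf bind_return_pmf)
  also have "\<dots> = bind_pmf (arrival_type lH lE) (\<lambda>T. has_edge d (compat pH pE T))"
    by (simp add: arr)
  finally have "pmf (map_pmf (\<lambda>l. 1 \<le> l) L) True =
      (1 - (1 - pH) ^ d) * (lH / (lH + lE)) + (1 - (1 - pE) ^ d) * (1 - lH / (lH + lE))"
    using lH lE pH pE by (simp add: arrival_type_bernoulli bind_map_pmf pmf_bind pmf_has_edge_True)
  also have "1 - lH / (lH + lE) = lE / (lH + lE)"
    using lH lE by (simp add: field_simps)
  finally show ?thesis
    by (simp add: match_prob_def add_divide_distrib mult.commute)
qed

lemma match_prob_pos: "0 < match_prob d lH lE pH pE"
proof -
  have "0 < 1 - (1 - pH) ^ d" "0 < 1 - (1 - pE) ^ d"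
    using pH pE d by (auto simp: power_less_one_iff)
  then show ?thesis
    using lH lE by (simp add: match_prob_def add_pos_pos)
qed

lemma conditional_expectation:
  "measure_pmf.expectation (cond_pmf L {l. 1 \<le> l}) real_of_int = 1 / match_prob d lH lE pH pE"
proof -
  let ?A = "{l :: int. 1 \<le> l}"
  have prob: "measure_pmf.prob L ?A = match_prob d lH lE pH pE"
    using pmf_matched by (simp add: pmf_map vimage_def)
  \<comment> \<open>Conditioning is meaningful because the event has positive probability.\<close>
  have ne: "set_pmf L \<inter> ?A \<noteq> {}"
    using prob match_prob_pos by (metis less_irrefl measure_empty measure_Int_set_pmf inf_commute)
  have "measure_pmf.expectation (cond_pmf L ?A) real_of_int =
      (\<integral>l. indicator ?A l / match_prob d lH lE pH pE * real_of_int l \<partial>L)"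
  \<comment> \<open>The conditional law has density indicator over probability with respect to
    \<open>L\<close>.\<close>
  proof -
    have density: "measure_pmf (cond_pmf L ?A) =
        density L (\<lambda>l. ennreal (indicator ?A l / match_prob d lH lE pH pE))"
      unfolding cond_pmf.rep_eq[OF ne] uniform_measure_def measure_pmf.emeasure_eq_measure prob
      using match_prob_pos by (intro density_cong) (auto simp: indicator_def divide_ennreal simp flip: ennreal_1)
    show ?thesis
      unfolding density using match_prob_pos by (subst integral_density) auto
  qed
  also have "\<dots> = measure_pmf.expectation L (\<lambda>l. indicator ?A l * real_of_int l) / match_prob d lH lE pH pE"
    by simp
  \<comment> \<open>Lengths are nonnegative integers, so the excluded values reduce to 0 and
    contribute nothing.\<close>
  also have "measure_pmf.expectation L (\<lambda>l. indicator ?A l * real_of_int l) =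
      measure_pmf.expectation L real_of_int"
    by (intro integral_cong_AE)
       (auto simp: AE_measure_pmf_iff indicator_def dest!: steady_length_nonneg)
  finally show ?thesis
    by (simp add: steady_length_expectation)
qed

end

section \<open>The limit of vanishing H compatibility\<close>

theorem proposition2:
  fixes lH lE pE :: real and d :: nat
  assumes "0 < lH" and "0 < lE" and "0 < pE" and "pE \<le> 1" and "1 \<le> d"
  shows "((\<lambda>pH. measure_pmf.expectation
                  (cond_pmf (steady_length d lH lE pH pE) {l. 1 \<le> l}) real_of_int)
          \<longlongrightarrow> (lH + lE * (1 - pE) ^ d) / (lE * (1 - (1 - pE) ^ d)) + 1) (at_right 0)"
proof -
  let ?c = "1 - (1 - pE) ^ d"
  have c: "0 < ?c"
    using assms by (simp add: power_less_one_iff)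
  \<comment> \<open>For fixed \<open>d\<close> the matching probability is continuous in
    \<open>pH\<close>, so the limit is found by inserting 0; the H term then vanishes.\<close>
  have "((\<lambda>pH. 1 / match_prob d lH lE pH pE) \<longlongrightarrow>
      1 / ((lH * (1 - (1 - 0) ^ d) + lE * ?c) / (lH + lE))) (at_right 0)"
    unfolding match_prob_def using assms c by (intro tendsto_intros) auto
  \<comment> \<open>The numerator \<open>lH + lE\<close> splits as
    \<open>(lH + lE * (1 - pE) ^ d) + lE * ?c\<close>, whose second summand yields the 1.\<close>
  also have "1 / ((lH * (1 - (1 - 0) ^ d) + lE * ?c) / (lH + lE)) =
      (lH + lE * (1 - pE) ^ d) / (lE * ?c) + 1"
    using assms c by (simp add: field_simps)
  finally have lim: "((\<lambda>pH. 1 / match_prob d lH lE pH pE) \<longlongrightarrow>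
      (lH + lE * (1 - pE) ^ d) / (lE * ?c) + 1) (at_right 0)" .
  have "\<forall>\<^sub>F pH in at_right 0. 0 < pH \<and> pH < (1 :: real)"
    using eventually_at_right_real[of 0 "1 :: real"] by simp
  then have "\<forall>\<^sub>F pH in at_right 0. 1 / match_prob d lH lE pH pE =
      measure_pmf.expectation (cond_pmf (steady_length d lH lE pH pE) {l. 1 \<le> l}) real_of_int"
  proof eventually_elim
    case (elim pH)
    then interpret chain_match_model d lH lE pH pE
      using assms by unfold_locales auto
    show ?case
      by (rule conditional_expectation[symmetric])
  qed
  with lim show ?thesis
    by (rule Lim_transform_eventually)
qed

end
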